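(* Let $g\ge 2$ be an integer, let $p$ be an odd prime and let $G$ be an extra-special group of order $p^{2g+1}$. Then $G$ is an admissible quotient of $\mathsf{B}_2(\Sigma_g)$ if and only if $g\equiv -1\pmod p$. In this case, the number $N_g(G)$ of admissible epimorphisms $\varphi\colon\mathsf{B}_2(\Sigma_g)\to G$ is given by $$N_g(G)=(p-1)\,p^{g(g+2)}\prod_{i=1}^g(p^{2i}-1).$$ In particular, $N_g(G)$ is independent of $G$ (i.e. it depends only on $p$ and $g$, and not on the isomorphism class of the extra-special group $G$ of order $p^{2g+1}$).
   Context: Commutators are $[x,y]=xyx^{-1}y^{-1}$. Let $\Sigma_g$ be a compact Riemann surface of genus $g$. The full braid group on two strings $\mathsf{B}_2(\Sigma_g)\simeq\pi_1(\operatorname{Sym}^2\Sigma_g-\delta)$ (with $\delta$ the diagonal) is the group generated by $a_1,b_1,\dots,a_g,b_g,\sigma$ subject to the relations: $[a_i,\sigma^{-1}a_i\sigma^{-1}]=1$ and $[b_i,\sigma^{-1}b_i\sigma^{-1}]=1$ for $1\le i\le g$; $[a_i,\sigma^{-1}a_j\sigma]=[a_i,\sigma^{-1}b_j\sigma]=[b_i,\sigma^{-1}a_j\sigma]=[b_i,\sigma^{-1}b_j\sigma]=1$ for $j<i$; $[a_i,\sigma^{-1}b_i\sigma^{-1}]=\sigma^2$ for $1\le i\le g$; and $[a_1,b_1^{-1}]\cdots[a_g,b_g^{-1}]=\sigma^2$. For a finite group $G$, a group epimorphism $\varphi\colon\mathsf{B}_2(\Sigma_g)\to G$ is called admissible if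 $\varphi(\sigma)$ has order $n\ge 2$ (i.e. $\varphi(\sigma)\neq 1$); $G$ is called an admissible quotient of $\mathsf{B}_2(\Sigma_g)$ if such a $\varphi$ exists. $N_g(G)$ denotes the total number of admissible epimorphisms $\mathsf{B}_2(\Sigma_g)\to G$. A finite $p$-group $G$ is extra-special if its center $Z(G)$ is cyclic of order $p$ and $G/Z(G)$ is a nontrivial elementary abelian $p$-group. *)

theory Defs
  imports "HOL-Algebra.Algebra" "HOL-Number_Theory.Number_Theory"
begin

section \<open>Groups given by generators and relations\<close>

text \<open>A letter \<open>(x, True)\<close> stands for the generator \<open>x\<close>, and \<open>(x, False)\<close> for its inverse.\<close>

type_synonym 'x word = "('x \<times> bool) list"

definition gen_word :: "'x \<Rightarrow> 'x word" where
  "gen_word x = [(x, True)]"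

definition inv_word :: "'x word \<Rightarrow> 'x word" where
  "inv_word w = rev (map (\<lambda>(x, e). (x, \<not> e)) w)"

definition comm_word :: "'x word \<Rightarrow> 'x word \<Rightarrow> 'x word" where
  "comm_word u v = u @ v @ inv_word u @ inv_word v"

definition words :: "'x set \<Rightarrow> 'x word set" where
  "words S = lists (S \<times> UNIV)"

text \<open>
  For a set \<open>R\<close> of pairs of words, \<open>pres_rel S R\<close> is the least congruence on the words over \<open>S\<close>
  that cancels adjacent inverse letters and identifies \<open>l\<close> with \<open>r\<close> for each relation
  \<open>(l, r) \<in> R\<close>.
\<close>

inductive_set pres_rel :: "'x set \<Rightarrow> ('x word \<times> 'x word) set \<Rightarrow> ('x word \<times> 'x word) set"
  for S R where
  refl: "u \<in> words S \<Longrightarrow> (u, u) \<in> pres_rel S R"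
| sym: "(u, v) \<in> pres_rel S R \<Longrightarrow> (v, u) \<in> pres_rel S R"
| trans: "(u, v) \<in> pres_rel S R \<Longrightarrow> (v, w) \<in> pres_rel S R \<Longrightarrow> (u, w) \<in> pres_rel S R"
| cancel: "u \<in> words S \<Longrightarrow> v \<in> words S \<Longrightarrow> x \<in> S \<Longrightarrow>
    (u @ [(x, e), (x, \<not> e)] @ v, u @ v) \<in> pres_rel S R"
| relation: "u \<in> words S \<Longrightarrow> v \<in> words S \<Longrightarrow> (l, r) \<in> R \<Longrightarrow> l \<in> words S \<Longrightarrow> r \<in> words S \<Longrightarrow>
    (u @ l @ v, u @ r @ v) \<in> pres_rel S R"

definition word_class :: "'x set \<Rightarrow> ('x word \<times> 'x word) set \<Rightarrow> 'x word \<Rightarrow> 'x word set" where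
  "word_class S R w = pres_rel S R `` {w}"

definition presented_group ::
  "'x set \<Rightarrow> ('x word \<times> 'x word) set \<Rightarrow> 'x word set monoid" where
  "presented_group S R =
     \<lparr>carrier = words S // pres_rel S R,
      monoid.mult = (\<lambda>U V. \<Union>u\<in>U. \<Union>v\<in>V. word_class S R (u @ v)),
      one = word_class S R []\<rparr>"

lemma words_append [simp]: "u @ v \<in> words S \<longleftrightarrow> u \<in> words S \<and> v \<in> words S"
  by (auto simp: words_def)

lemma words_Nil [simp]: "[] \<in> words S"
  by (simp add: words_def)

lemma words_Cons [simp]: "(x, e) # w \<in> words S \<longleftrightarrow> x \<in> S \<and> w \<in> words S"
  by (auto simp: words_def)

lemma inv_word_in_words [simp]: "inv_word w \<in> words S \<longleftrightarrow> w \<in> words S"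
  by (induction w) (auto simp: inv_word_def)

lemma gen_word_in_words [simp]: "gen_word x \<in> words S \<longleftrightarrow> x \<in> S"
  by (simp add: gen_word_def)

lemma pres_rel_words:
  assumes "(u, v) \<in> pres_rel S R"
  shows "u \<in> words S" "v \<in> words S"
proof -
  from assms have "u \<in> words S \<and> v \<in> words S"
    by induction auto
  thus "u \<in> words S" "v \<in> words S" by auto
qed

lemma equiv_pres_rel: "equiv (words S) (pres_rel S R)"
  by (auto intro!: equivI refl_onI symI transI intro: pres_rel.intros dest: pres_rel_words)

lemma pres_rel_context:
  assumes "(u, v) \<in> pres_rel S R" "a \<in> words S" "b \<in> words S"
  shows "(a @ u @ b, a @ v @ b) \<in> pres_rel S R"
  using assms(1)
proof induction
  case (refl u)
  thus ?case using assms by (intro pres_rel.refl) auto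
next
  case (sym u v)
  thus ?case by (blast intro: pres_rel.sym)
next
  case (trans u v w)
  thus ?case by (blast intro: pres_rel.trans)
next
  case (cancel u v x e)
  thus ?case using pres_rel.cancel[of "a @ u" S "v @ b" x e R] assms by simp
next
  case (relation u v l r)
  thus ?case using pres_rel.relation[of "a @ u" S "v @ b" l r R] assms by simp
qed

lemma pres_rel_append:
  assumes "(u, u') \<in> pres_rel S R" "(v, v') \<in> pres_rel S R"
  shows "(u @ v, u' @ v') \<in> pres_rel S R"
  using pres_rel_context[OF assms(1), of "[]" v] pres_rel_context[OF assms(2), of u' "[]"]
    pres_rel_words[OF assms(1)] pres_rel_words[OF assms(2)]
  by (auto intro: pres_rel.trans)

lemma word_class_eq_iff:
  assumes "u \<in> words S" "v \<in> words S"
  shows "word_class S R u = word_class S R v \<longleftrightarrow> (u, v) \<in> pres_rel S R"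
  using assms eq_equiv_class_iff[OF equiv_pres_rel] by (simp add: word_class_def)

lemma carrier_presented_group:
  "carrier (presented_group S R) = word_class S R ` words S"
  by (auto simp: presented_group_def quotient_def word_class_def)

lemma mult_presented_group:
  assumes "u \<in> words S" "v \<in> words S"
  shows "word_class S R u \<otimes>\<^bsub>presented_group S R\<^esub> word_class S R v = word_class S R (u @ v)"
proof -
  have *: "word_class S R (u' @ v') = word_class S R (u @ v)"
    if "u' \<in> word_class S R u" "v' \<in> word_class S R v" for u' v'
  proof -
    from that have "(u, u') \<in> pres_rel S R" "(v, v') \<in> pres_rel S R"
      by (auto simp: word_class_def)
    from this[THEN pres_rel.sym] show ?thesis
      using equiv_class_eq[OF equiv_pres_rel] pres_rel_append
      unfolding word_class_def by metis
  qed
  have "u \<in> word_class S R u" "v \<in> word_class S R v"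
    using assms by (auto simp: word_class_def intro: pres_rel.refl)
  hence "(\<Union>u'\<in>word_class S R u. \<Union>v'\<in>word_class S R v. word_class S R (u' @ v')) =
      word_class S R (u @ v)"
    using * by blast
  thus ?thesis by (simp add: presented_group_def)
qed

lemma one_presented_group: "\<one>\<^bsub>presented_group S R\<^esub> = word_class S R []"
  by (simp add: presented_group_def)

lemma pres_rel_inv_word_left:
  assumes "w \<in> words S"
  shows "(inv_word w @ w, []) \<in> pres_rel S R"
  using assms
proof (induction w)
  case Nil
  show ?case by (auto simp: inv_word_def intro: pres_rel.refl)
next
  case (Cons a w)
  obtain x e where a: "a = (x, e)" by force
  with Cons.prems have w: "w \<in> words S" and x: "x \<in> S" by auto
  have "(inv_word w @ [(x, \<not> e), (x, \<not> \<not> e)] @ w, inv_word w @ w) \<in> pres_rel S R"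
    using w x by (intro pres_rel.cancel) auto
  moreover have "inv_word (a # w) @ a # w = inv_word w @ [(x, \<not> e), (x, \<not> \<not> e)] @ w"
    by (simp add: a inv_word_def)
  ultimately show ?case
    using Cons.IH[OF w] by (metis pres_rel.trans)
qed

lemma group_presented_group: "group (presented_group S R)"
proof (rule groupI)
  fix U assume "U \<in> carrier (presented_group S R)"
  then obtain u where u: "u \<in> words S" "U = word_class S R u"
    by (auto simp: carrier_presented_group)
  have "word_class S R (inv_word u) \<otimes>\<^bsub>presented_group S R\<^esub> U = \<one>\<^bsub>presented_group S R\<^esub>"
    using u pres_rel_inv_word_left[of u S R]
    by (simp add: mult_presented_group one_presented_group word_class_eq_iff)
  thus "\<exists>V\<in>carrier (presented_group S R).
      V \<otimes>\<^bsub>presented_group S R\<^esub> U = \<one>\<^bsub>presented_group S R\<^esub>"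
    using u by (auto simp: carrier_presented_group)
qed (auto simp: carrier_presented_group mult_presented_group one_presented_group)

section \<open>The braid group on two strings of a closed surface\<close>

datatype braid_gen = GenA nat | GenB nat | GenS

abbreviation a_word :: "nat \<Rightarrow> braid_gen word" where "a_word i \<equiv> gen_word (GenA i)"
abbreviation b_word :: "nat \<Rightarrow> braid_gen word" where "b_word i \<equiv> gen_word (GenB i)"
abbreviation s_word :: "braid_gen word" where "s_word \<equiv> gen_word GenS"

definition braid_gens :: "nat \<Rightarrow> braid_gen set" where
  "braid_gens g = GenA ` {1..g} \<union> GenB ` {1..g} \<union> {GenS}"

definition braid_rels :: "nat \<Rightarrow> (braid_gen word \<times> braid_gen word) set" where
  "braid_rels g =
     {(comm_word (a_word i) (inv_word s_word @ a_word i @ inv_word s_word), []) |i. i \<in> {1..g}}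
   \<union> {(comm_word (b_word i) (inv_word s_word @ b_word i @ inv_word s_word), []) |i. i \<in> {1..g}}
   \<union> {(comm_word (a_word i) (inv_word s_word @ a_word j @ s_word), []) |i j. 1 \<le> j \<and> j < i \<and> i \<le> g}
   \<union> {(comm_word (a_word i) (inv_word s_word @ b_word j @ s_word), []) |i j. 1 \<le> j \<and> j < i \<and> i \<le> g}
   \<union> {(comm_word (b_word i) (inv_word s_word @ a_word j @ s_word), []) |i j. 1 \<le> j \<and> j < i \<and> i \<le> g}
   \<union> {(comm_word (b_word i) (inv_word s_word @ b_word j @ s_word), []) |i j. 1 \<le> j \<and> j < i \<and> i \<le> g}
   \<union> {(comm_word (a_word i) (inv_word s_word @ b_word i @ inv_word s_word), s_word @ s_word)
        |i. i \<in> {1..g}}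
   \<union> {(concat (map (\<lambda>i. comm_word (a_word i) (inv_word (b_word i))) [1..<Suc g]),
        s_word @ s_word)}"

lemma comm_word_in_words [simp]: "comm_word u v \<in> words S \<longleftrightarrow> u \<in> words S \<and> v \<in> words S"
  by (auto simp: comm_word_def)

lemma concat_in_words: "(\<And>w. w \<in> set ws \<Longrightarrow> w \<in> words S) \<Longrightarrow> concat ws \<in> words S"
  by (induction ws) auto

lemma braid_rels_in_words:
  "braid_rels g \<subseteq> words (braid_gens g) \<times> words (braid_gens g)"
  by (auto simp: braid_rels_def braid_gens_def intro!: concat_in_words)

definition braid_group2 :: "nat \<Rightarrow> braid_gen word set monoid" where
  "braid_group2 g = presented_group (braid_gens g) (braid_rels g)"

definition braid_sigma :: "nat \<Rightarrow> braid_gen word set" where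
  "braid_sigma g = word_class (braid_gens g) (braid_rels g) s_word"

text \<open>
  Elements of \<open>hom\<close> and \<open>epi\<close> are unconstrained off the carrier; requiring extensionality makes
  each epimorphism correspond to exactly one HOL function, so that counting is meaningful.
\<close>

definition admissible_epis ::
  "nat \<Rightarrow> ('a, 'm) monoid_scheme \<Rightarrow> (braid_gen word set \<Rightarrow> 'a) set" where
  "admissible_epis g G =
     {\<phi> \<in> epi (braid_group2 g) G.
        \<phi> \<in> extensional (carrier (braid_group2 g)) \<and> 2 \<le> group.ord G (\<phi> (braid_sigma g))}"

definition admissible_quotient :: "nat \<Rightarrow> ('a, 'm) monoid_scheme \<Rightarrow> bool" where
  "admissible_quotient g G \<longleftrightarrow> admissible_epis g G \<noteq> {}"

definition num_admissible_epis :: "nat \<Rightarrow> ('a, 'm) monoid_scheme \<Rightarrow> nat" where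
  "num_admissible_epis g G = card (admissible_epis g G)"

section \<open>Extra-special groups\<close>

definition center :: "('a, 'm) monoid_scheme \<Rightarrow> 'a set" where
  "center G = {z \<in> carrier G. \<forall>x\<in>carrier G. z \<otimes>\<^bsub>G\<^esub> x = x \<otimes>\<^bsub>G\<^esub> z}"

definition elementary_abelian :: "nat \<Rightarrow> ('a, 'm) monoid_scheme \<Rightarrow> bool" where
  "elementary_abelian p G \<longleftrightarrow>
     comm_group G \<and> (\<forall>x\<in>carrier G. x [^]\<^bsub>G\<^esub> p = \<one>\<^bsub>G\<^esub>)"

definition extra_special :: "nat \<Rightarrow> ('a, 'm) monoid_scheme \<Rightarrow> bool" where
  "extra_special p G \<longleftrightarrow>
     Factorial_Ring.prime p \<and> group G \<and> finite (carrier G) \<and> (\<exists>n. order G = p ^ n) \<and>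
     cyclic_group (subgroup_generated G (center G)) \<and> card (center G) = p \<and>
     elementary_abelian p (G Mod center G) \<and> order (G Mod center G) \<noteq> 1"

end

theory Submission
  imports Defs
begin

text \<open>
  Why the theorem holds. In an extra-special group \<open>G\<close> all commutators lie in the centre \<open>Z\<close>, which
  has prime order \<open>p\<close>, and \<open>(x, y) \<mapsto> [x, y]\<close> is biadditive. Let \<open>\<phi>\<close> be an admissible epimorphism
  and \<open>s = \<phi>(\<sigma>)\<close>. The relation \<open>[a\<^sub>1, \<sigma>\<inverse> b\<^sub>1 \<sigma>\<inverse>] = \<sigma>\<^sup>2\<close> makes \<open>s\<^sup>2\<close> a commutator, hence central;
  since \<open>G\<close> has odd order, \<open>s\<close> is a power of \<open>s\<^sup>2\<close> and so is central as well. All occurrences of \<open>\<sigma>\<close>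
  inside commutators then drop out, and the relations say that the pairs \<open>(\<phi>(a\<^sub>i), \<phi>(b\<^sub>i))\<close> satisfy
  \<open>[a\<^sub>i, b\<^sub>i] = s\<^sup>2\<close> while entries of different pairs commute. Such a list of pairs is called a frame
  below; it lifts a symplectic basis of \<open>G/Z\<close>. The surface relation becomes \<open>s\<^bsup>-2g\<^esup> = s\<^sup>2\<close>, and as
  \<open>s\<^sup>2\<close> has order \<open>p\<close> this says that \<open>p\<close> divides \<open>g + 1\<close>
  (\<open>respects_braid_rels_iff\<close>).

  Conversely, if \<open>p\<close> divides \<open>g + 1\<close>, each \<open>s \<in> Z - {1}\<close> together with a frame of length \<open>g\<close> for
  \<open>s\<^sup>2\<close> defines a homomorphism, and it is onto because a frame of full length generates \<open>G\<close>
  (\<open>frame_generates\<close>). So \<open>N\<^sub>g(G)\<close> is \<open>p - 1\<close> times the number of frames for a fixed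
  value \<open>c \<noteq> 1\<close> in \<open>Z\<close>.

  Frames are counted (\<open>card_frames\<close>) by peeling off one hyperbolic pair at a time, without passing to the vector
  space \<open>G/Z\<close>. In a subgroup \<open>C\<close> of order \<open>p\<^bsup>2m+1\<^esup>\<close> whose centre is \<open>Z\<close>, any of the \<open>p\<^bsup>2m+1\<^esup> - p\<close>
  elements \<open>a\<close> outside \<open>Z\<close> may come first, and the equation \<open>[a, b] = c\<close> then has \<open>p\<^bsup>2m\<^esup>\<close>
  solutions \<open>b\<close>, because \<open>[a, _]\<close> is a homomorphism of \<open>C\<close> onto \<open>Z\<close>. The rest of the frame lies in the centralizer of
  \<open>a\<close> and \<open>b\<close> in \<open>C\<close>, which has order \<open>p\<^bsup>2m-1\<^esup>\<close> and again has centre \<open>Z\<close>.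
\<close>

section \<open>Homomorphisms out of a presented group\<close>

definition word_value :: "('a, 'm) monoid_scheme \<Rightarrow> ('x \<Rightarrow> 'a) \<Rightarrow> 'x word \<Rightarrow> 'a" where
  "word_value G f w =
     foldr (\<lambda>(x, e) r. (if e then f x else inv\<^bsub>G\<^esub> f x) \<otimes>\<^bsub>G\<^esub> r) w \<one>\<^bsub>G\<^esub>"

definition commutator :: "('a, 'm) monoid_scheme \<Rightarrow> 'a \<Rightarrow> 'a \<Rightarrow> 'a" where
  "commutator G x y = x \<otimes>\<^bsub>G\<^esub> y \<otimes>\<^bsub>G\<^esub> inv\<^bsub>G\<^esub> x \<otimes>\<^bsub>G\<^esub> inv\<^bsub>G\<^esub> y"

context group
begin

lemma word_value_Nil [simp]: "word_value G f [] = \<one>"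
  by (simp add: word_value_def)

lemma word_value_Cons:
  "word_value G f ((x, e) # w) = (if e then f x else inv f x) \<otimes> word_value G f w"
  by (simp add: word_value_def)

lemma word_value_closed:
  assumes "f \<in> S \<rightarrow> carrier G" "w \<in> words S"
  shows "word_value G f w \<in> carrier G"
  using assms(2)
proof (induction w)
  case (Cons a w)
  thus ?case using assms(1) by (cases a) (auto simp: word_value_Cons)
qed simp

lemma word_value_gen:
  assumes "f \<in> S \<rightarrow> carrier G" "x \<in> S"
  shows "word_value G f (gen_word x) = f x"
  using funcset_mem[OF assms] by (simp add: gen_word_def word_value_Cons)

lemma word_value_append:
  assumes "f \<in> S \<rightarrow> carrier G" "u \<in> words S" "v \<in> words S"
  shows "word_value G f (u @ v) = word_value G f u \<otimes> word_value G f v"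
  using assms(2)
proof (induction u)
  case Nil
  thus ?case using word_value_closed[OF assms(1,3)] by simp
next
  case (Cons a u)
  obtain x e where a: "a = (x, e)" by force
  have "f x \<in> carrier G" using Cons.prems assms(1) a by auto
  thus ?case using Cons word_value_closed[OF assms(1)] assms(3)
    by (auto simp: a word_value_Cons m_assoc)
qed

lemma word_value_inv:
  assumes "f \<in> S \<rightarrow> carrier G" "w \<in> words S"
  shows "word_value G f (inv_word w) = inv (word_value G f w)"
  using assms(2)
proof (induction w)
  case Nil
  thus ?case by (simp add: inv_word_def)
next
  case (Cons a w)
  obtain x e where a: "a = (x, e)" by force
  with Cons.prems have x: "x \<in> S" and w: "w \<in> words S" by auto
  have fx: "f x \<in> carrier G" using x assms(1) by auto
  have "inv_word (a # w) = inv_word w @ [(x, \<not> e)]"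
    by (simp add: a inv_word_def)
  thus ?case using Cons.IH[OF w] word_value_closed[OF assms(1)] fx x w
    by (auto simp: word_value_append[OF assms(1)] a word_value_Cons inv_mult_group)
qed

lemma word_value_comm:
  assumes "f \<in> S \<rightarrow> carrier G" "u \<in> words S" "v \<in> words S"
  shows "word_value G f (comm_word u v) = commutator G (word_value G f u) (word_value G f v)"
  using assms word_value_closed[OF assms(1)]
  by (simp add: comm_word_def commutator_def word_value_append[OF assms(1)]
      word_value_inv[OF assms(1)] m_assoc)

text \<open>
  The relations in \<open>R\<close> generate the congruence, so an assignment of generators that satisfies them
  takes equal values on congruent words, and therefore descends to the presented group.
\<close>

lemma word_value_respects:
  assumes "(u, v) \<in> pres_rel S R" "f \<in> S \<rightarrow> carrier G"
    and "\<And>l r. (l, r) \<in> R \<Longrightarrow> word_value G f l = word_value G f r"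
  shows "word_value G f u = word_value G f v"
  using assms(1)
proof induction
  case (cancel u v x e)
  have "word_value G f [(x, e), (x, \<not> e)] = \<one>"
    using funcset_mem[OF assms(2) cancel(3)] by (simp add: word_value_Cons)
  thus ?case using cancel word_value_closed[OF assms(2)]
    by (simp add: word_value_append[OF assms(2)] del: append_Cons)
next
  case (relation u v l r)
  thus ?case using assms(3) by (simp add: word_value_append[OF assms(2)])
qed auto

text \<open>
  A homomorphism is determined by its values on the generators: this gives uniqueness in the
  universal property.
\<close>

lemma hom_word_class:
  assumes "\<phi> \<in> hom (presented_group S R) G" "w \<in> words S"
  shows "\<phi> (word_class S R w) = word_value G (\<lambda>x. \<phi> (word_class S R (gen_word x))) w"
proof -
  interpret P: group "presented_group S R" by (rule group_presented_group)
  interpret h: group_hom "presented_group S R" G \<phi>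
    using assms(1) by unfold_locales
  show ?thesis using assms(2)
  proof (induction w)
    case Nil
    show ?case using h.hom_one by (simp add: one_presented_group)
  next
    case (Cons a w)
    obtain x e where a: "a = (x, e)" by force
    with Cons.prems have x: "x \<in> S" and w: "w \<in> words S" by auto
    let ?x = "word_class S R (gen_word x)"
    have cx: "?x \<in> carrier (presented_group S R)" and cw: "word_class S R w \<in> carrier (presented_group S R)"
      using x w by (auto simp: carrier_presented_group)
    \<comment> \<open>A letter with a negative exponent is itself a word; its class must be identified with a group inverse.\<close>
    have inverse: "word_class S R [(x, False)] = inv\<^bsub>presented_group S R\<^esub> ?x"
    proof (rule P.inv_equality[symmetric])
      show "word_class S R [(x, False)] \<otimes>\<^bsub>presented_group S R\<^esub> ?x = \<one>\<^bsub>presented_group S R\<^esub>"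
        using x pres_rel_inv_word_left[of "gen_word x" S R]
        by (simp add: mult_presented_group one_presented_group word_class_eq_iff)
           (simp add: inv_word_def gen_word_def)
    qed (use x in \<open>auto simp: carrier_presented_group\<close>)
    have "word_class S R (a # w) = word_class S R [(x, e)] \<otimes>\<^bsub>presented_group S R\<^esub> word_class S R w"
      using x w by (subst mult_presented_group) (auto simp: a)
    also have "\<phi> \<dots> = \<phi> (word_class S R [(x, e)]) \<otimes> \<phi> (word_class S R w)"
      using x cw by (intro h.hom_mult) (auto simp: carrier_presented_group)
    also have "\<phi> (word_class S R [(x, e)]) = (if e then \<phi> ?x else inv (\<phi> ?x))"
      using inverse cx by (auto simp: gen_word_def)
    finally show ?case using Cons.IH[OF w] by (simp add: a word_value_Cons)
  qed
qed

lemma exists_presented_hom: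
  assumes f: "f \<in> S \<rightarrow> carrier G"
    and R: "\<And>l r. (l, r) \<in> R \<Longrightarrow> word_value G f l = word_value G f r"
  obtains \<phi> where "\<phi> \<in> hom (presented_group S R) G"
    "\<phi> \<in> extensional (carrier (presented_group S R))"
    "\<And>w. w \<in> words S \<Longrightarrow> \<phi> (word_class S R w) = word_value G f w"
proof
  let ?\<phi> = "\<lambda>U\<in>carrier (presented_group S R). word_value G f (SOME u. u \<in> U)"
  show val: "?\<phi> (word_class S R w) = word_value G f w" if w: "w \<in> words S" for w
  proof -
    have "w \<in> word_class S R w"
      using w by (auto simp: word_class_def intro: pres_rel.refl)
    hence "(SOME u. u \<in> word_class S R w) \<in> word_class S R w" by (rule someI)
    hence "(w, SOME u. u \<in> word_class S R w) \<in> pres_rel S R" by (simp add: word_class_def)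
    from word_value_respects[OF this f R] show ?thesis
      using w by (simp add: carrier_presented_group)
  qed
  show "?\<phi> \<in> hom (presented_group S R) G"
  proof (rule homI)
    fix U V assume "U \<in> carrier (presented_group S R)" "V \<in> carrier (presented_group S R)"
    then obtain u v where "u \<in> words S" "U = word_class S R u" "v \<in> words S" "V = word_class S R v"
      by (auto simp: carrier_presented_group)
    thus "?\<phi> (U \<otimes>\<^bsub>presented_group S R\<^esub> V) = ?\<phi> U \<otimes> ?\<phi> V"
      by (simp only: mult_presented_group val words_append word_value_append[OF f])
  next
    fix U assume "U \<in> carrier (presented_group S R)"
    then obtain u where "u \<in> words S" "U = word_class S R u"
      by (auto simp: carrier_presented_group)
    thus "?\<phi> U \<in> carrier G"
      by (simp only: val word_value_closed[OF f])
  qed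
qed (rule restrict_extensional)

text \<open>
  The universal property of a presentation, in a form suited to counting: restricting to extensional
  functions on both sides makes the correspondence between homomorphisms and solutions of the
  relations a bijection. Relations with letters outside \<open>S\<close> impose nothing on the presented group,
  but would constrain the right-hand side, so they have to be excluded.
\<close>

lemma bij_betw_presented_homs:
  assumes R: "R \<subseteq> words S \<times> words S"
  shows "bij_betw (\<lambda>\<phi>. \<lambda>x\<in>S. \<phi> (word_class S R (gen_word x)))
    {\<phi> \<in> hom (presented_group S R) G. \<phi> \<in> extensional (carrier (presented_group S R))}
    {f \<in> S \<rightarrow>\<^sub>E carrier G. \<forall>(l, r)\<in>R. word_value G f l = word_value G f r}"
    (is "bij_betw ?F ?H ?A")
proof -
  have val: "\<phi> (word_class S R w) = word_value G (?F \<phi>) w"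
    if "\<phi> \<in> hom (presented_group S R) G" "w \<in> words S" for \<phi> w
  proof -
    have "word_value G f w = word_value G (restrict f S) w" for f
      using that(2) by (induction w) (auto simp: word_value_Cons)
    thus ?thesis using hom_word_class[OF that] by simp
  qed
  have "inj_on ?F ?H"
  proof (rule inj_onI)
    fix \<phi> \<psi> assume *: "\<phi> \<in> ?H" "\<psi> \<in> ?H" "?F \<phi> = ?F \<psi>"
    hence "\<phi> (word_class S R w) = \<psi> (word_class S R w)" if "w \<in> words S" for w
      using val[of \<phi> w] val[of \<psi> w] that by simp
    with *(1,2) show "\<phi> = \<psi>"
      by (intro extensionalityI[of \<phi> "carrier (presented_group S R)"])
         (auto simp: carrier_presented_group)
  qed
  moreover have "?F \<phi> \<in> ?A" if \<phi>: "\<phi> \<in> ?H" for \<phi>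
  proof -
    have "word_value G (?F \<phi>) l = word_value G (?F \<phi>) r" if lr: "(l, r) \<in> R" for l r
    proof -
      have w: "l \<in> words S" "r \<in> words S" using lr R by auto
      have "(l, r) \<in> pres_rel S R"
        using pres_rel.relation[of "[]" S "[]" l r R] lr w by simp
      hence "word_class S R l = word_class S R r" using w by (simp add: word_class_eq_iff)
      thus ?thesis using w \<phi> val[of \<phi> l] val[of \<phi> r] by simp
    qed
    moreover have "?F \<phi> \<in> S \<rightarrow>\<^sub>E carrier G"
      using \<phi> by (auto simp: hom_def Pi_iff carrier_presented_group)
    ultimately show ?thesis by blast
  qed
  moreover have "f \<in> ?F ` ?H" if f: "f \<in> ?A" for f
  proof -
    have f': "f \<in> S \<rightarrow> carrier G" using f by (auto simp: PiE_iff)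
    have "word_value G f l = word_value G f r" if "(l, r) \<in> R" for l r
      using f that by auto
    from exists_presented_hom[OF f' this]
    obtain \<phi> where \<phi>: "\<phi> \<in> hom (presented_group S R) G"
        "\<phi> \<in> extensional (carrier (presented_group S R))"
      and v: "\<And>w. w \<in> words S \<Longrightarrow> \<phi> (word_class S R w) = word_value G f w"
      by metis
    have "?F \<phi> = f"
    proof
      show "?F \<phi> x = f x" for x
        using f v[of "gen_word x"] word_value_gen[OF f', of x] by (cases "x \<in> S") auto
    qed
    with \<phi> show ?thesis by (intro image_eqI[of _ _ \<phi>]) simp_all
  qed
  ultimately show ?thesis unfolding bij_betw_def by (intro conjI equalityI image_subsetI subsetI)
qed

end

section \<open>Groups with central commutators and centre of prime order\<close>

text \<open>
  The properties of an extra-special group on which the count rests: commutators behave like an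
  alternating bilinear form with values in the centre, whose prime order makes it a one-dimensional
  target.
\<close>

locale prime_center_group = group G for G :: "('a, 'm) monoid_scheme" (structure) +
  fixes p :: nat
  assumes finite_carrier: "finite (carrier G)"
    and prime: "Factorial_Ring.prime p"
    and card_center: "card (center G) = p"
    and commutator_central:
      "\<lbrakk>x \<in> carrier G; y \<in> carrier G\<rbrakk> \<Longrightarrow> commutator G x y \<in> center G"

lemma (in group) center_imp_carrier: "x \<in> center G \<Longrightarrow> x \<in> carrier G"
  by (simp add: center_def)

lemma (in group) center_subgroup: "subgroup (center G) G"
proof (rule subgroupI)
  show "center G \<noteq> {}" by (auto simp: center_def)
next
  fix a assume a: "a \<in> center G"
  have "inv a \<otimes> x = x \<otimes> inv a" if "x \<in> carrier G" for x
  proof -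
    have ac: "a \<in> carrier G" and ax: "a \<otimes> x = x \<otimes> a" using a that by (auto simp: center_def)
    have "inv a \<otimes> x = inv a \<otimes> (x \<otimes> a) \<otimes> inv a" using ac that by (simp add: m_assoc)
    also have "\<dots> = inv a \<otimes> (a \<otimes> x) \<otimes> inv a" by (simp add: ax)
    also have "\<dots> = x \<otimes> inv a" using ac that by (simp add: m_assoc[symmetric])
    finally show ?thesis .
  qed
  thus "inv a \<in> center G" using a by (simp add: center_def)
next
  fix a b assume ab: "a \<in> center G" "b \<in> center G"
  have "a \<otimes> b \<otimes> x = x \<otimes> (a \<otimes> b)" if x: "x \<in> carrier G" for x
  proof -
    have c: "a \<in> carrier G" "b \<in> carrier G" and bx: "b \<otimes> x = x \<otimes> b" and ax: "a \<otimes> x = x \<otimes> a"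
      using ab x by (auto simp: center_def)
    have "a \<otimes> b \<otimes> x = a \<otimes> (x \<otimes> b)" using c x bx by (simp only: m_assoc)
    also have "\<dots> = x \<otimes> a \<otimes> b" using c x ax by (simp only: m_assoc[symmetric])
    finally show ?thesis using c x by (simp only: m_assoc)
  qed
  moreover have "a \<otimes> b \<in> carrier G" using ab by (intro m_closed center_imp_carrier)
  ultimately show "a \<otimes> b \<in> center G" by (simp add: center_def)
qed (auto simp: center_def)

lemma (in group) commutator_closed [simp]:
  "\<lbrakk>x \<in> carrier G; y \<in> carrier G\<rbrakk> \<Longrightarrow> commutator G x y \<in> carrier G"
  by (simp add: commutator_def)

text \<open>
  Moving the inverses to the other side turns statements about commutators into equations between products.
\<close>

lemma (in group) commutator_eq_iff:
  assumes "x \<in> carrier G" "y \<in> carrier G" "z \<in> carrier G"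
  shows "commutator G x y = z \<longleftrightarrow> x \<otimes> y = z \<otimes> (y \<otimes> x)"
proof -
  have "commutator G x y = (x \<otimes> y) \<otimes> inv (y \<otimes> x)"
    using assms by (simp add: commutator_def inv_mult_group m_assoc)
  thus ?thesis using assms by (metis inv_solve_right m_closed)
qed

lemma (in group) commutator_swap:
  assumes "x \<in> carrier G" "y \<in> carrier G"
  shows "commutator G y x = inv (commutator G x y)"
  using assms by (simp add: commutator_def inv_mult_group m_assoc)

lemma (in group) commutator_self [simp]:
  "x \<in> carrier G \<Longrightarrow> commutator G x x = \<one>"
  by (simp add: commutator_eq_iff)

lemma (in group) commutator_one [simp]:
  "x \<in> carrier G \<Longrightarrow> commutator G x \<one> = \<one>"
  by (simp add: commutator_eq_iff)

lemma (in group) mem_center_iff: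
  "x \<in> center G \<longleftrightarrow> x \<in> carrier G \<and> (\<forall>y\<in>carrier G. commutator G x y = \<one>)"
  by (auto simp: center_def commutator_eq_iff)

lemma (in group) commutator_center_right [simp]:
  "\<lbrakk>x \<in> carrier G; z \<in> center G\<rbrakk> \<Longrightarrow> commutator G x z = \<one>"
  using commutator_swap[of z x] by (simp add: mem_center_iff)

context prime_center_group
begin

lemma center_commute: "\<lbrakk>z \<in> center G; x \<in> carrier G\<rbrakk> \<Longrightarrow> z \<otimes> x = x \<otimes> z"
  by (simp add: center_def)

text \<open>Central commutators can be pulled out of a product, which makes \<open>[x, _]\<close> a homomorphism.\<close>

lemma commutator_mult_right:
  assumes "x \<in> carrier G" "y \<in> carrier G" "z \<in> carrier G"
  shows "commutator G x (y \<otimes> z) = commutator G x y \<otimes> commutator G x z"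
proof -
  let ?k = "commutator G x y" and ?l = "commutator G x z"
  have k: "?k \<in> center G" "?l \<in> center G" using assms by (auto intro: commutator_central)
  have c: "?k \<in> carrier G" "?l \<in> carrier G" using assms by auto
  have 1: "x \<otimes> y = ?k \<otimes> (y \<otimes> x)" and 2: "x \<otimes> z = ?l \<otimes> (z \<otimes> x)"
    using assms commutator_eq_iff c by blast+
  have "x \<otimes> (y \<otimes> z) = (x \<otimes> y) \<otimes> z" using assms by (simp add: m_assoc)
  also have "\<dots> = ?k \<otimes> (y \<otimes> (x \<otimes> z))" using assms c by (subst 1) (simp add: m_assoc)
  also have "\<dots> = ?k \<otimes> ((y \<otimes> ?l) \<otimes> (z \<otimes> x))" using assms c by (subst 2) (simp add: m_assoc)
  also have "\<dots> = (?k \<otimes> ?l) \<otimes> ((y \<otimes> z) \<otimes> x)"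
  proof -
    have "y \<otimes> ?l \<otimes> (z \<otimes> x) = ?l \<otimes> ((y \<otimes> z) \<otimes> x)"
      using assms c by (simp add: center_commute[OF k(2) assms(2), symmetric] m_assoc)
    thus ?thesis using assms c by (simp add: m_assoc)
  qed
  finally show ?thesis using assms c by (subst commutator_eq_iff) auto
qed

lemma commutator_inv_right:
  assumes "x \<in> carrier G" "y \<in> carrier G"
  shows "commutator G x (inv y) = inv (commutator G x y)"
proof -
  have "commutator G x (inv y) \<otimes> commutator G x y = \<one>"
    using assms by (simp flip: commutator_mult_right)
  thus ?thesis using assms by (intro inv_equality[symmetric]) auto
qed

lemma commutator_pow_right:
  assumes "x \<in> carrier G" "y \<in> carrier G"
  shows "commutator G x (y [^] (k::nat)) = commutator G x y [^] k"
  using assms by (induction k) (simp_all add: commutator_mult_right)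

lemma ord_center:
  assumes "c \<in> center G" "c \<noteq> \<one>"
  shows "ord c = p"
proof -
  have c: "c \<in> carrier G" using assms by (simp add: center_def)
  interpret Z: group "G\<lparr>carrier := center G\<rparr>"
    using subgroup.subgroup_is_group[OF center_subgroup is_group] .
  have "c [^] p = \<one>"
    using Z.pow_order_eq_1[of c] assms card_center by (simp add: order_def flip: nat_pow_consistent)
  hence "ord c dvd p" using c by (simp add: pow_eq_id)
  thus ?thesis using prime c assms(2) ord_eq_1 prime_nat_iff by blast
qed

lemma center_power:
  assumes "c \<in> center G" "c \<noteq> \<one>" "z \<in> center G"
  obtains k :: nat where "z = c [^] k"
proof -
  have c: "c \<in> carrier G" using assms by (simp add: center_def)
  have "generate G {c} \<subseteq> center G"
    using assms center_subgroup by (intro generate_subgroup_incl) auto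
  moreover have "card (generate G {c}) = card (center G)"
    using generate_pow_card[OF c] ord_center[OF assms(1,2)] card_center by simp
  moreover have "finite (center G)"
    using finite_carrier by (auto simp: center_def)
  ultimately have "generate G {c} = center G"
    by (simp add: card_subset_eq)
  thus thesis using that assms generate_pow_on_finite_carrier[OF finite_carrier c] by auto
qed

text \<open>
  If \<open>a\<close> does not centralize \<open>C\<close>, then \<open>[a, _]\<close> maps \<open>C\<close> onto the centre, as a nontrivial element
  of the centre generates it. The \<open>p\<close> fibres are translates of each other and so have equal size.
\<close>

lemma card_commutator_fibre:
  assumes C: "subgroup C G" and a: "a \<in> carrier G" and x: "x \<in> C" "commutator G a x \<noteq> \<one>"
    and z: "z \<in> center G"
  shows "card {y \<in> C. commutator G a y = z} * p = card C"
proof -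
  let ?F = "\<lambda>z. {y \<in> C. commutator G a y = z}"
  have car: "y \<in> carrier G" if "y \<in> C" for y using subgroup.mem_carrier[OF C that] .
  have finC: "finite C" using finite_carrier subgroup.subset[OF C] finite_subset by blast
  have fib: "card (?F z) = card (?F \<one>)" if z: "z \<in> center G" for z
  proof -
    obtain k :: nat where k: "z = commutator G a x [^] k"
      using center_power[OF commutator_central x(2) z] a x car by blast
    define b where "b = x [^] k"
    have "b \<in> C"
      unfolding b_def using x subgroup.one_closed[OF C] subgroup.m_closed[OF C] by (induction k) auto
    moreover have "commutator G a b = z"
      using a x car k commutator_pow_right by (simp add: b_def)
    ultimately have b: "b \<in> C" "commutator G a b = z" .
    have zc: "z \<in> carrier G" using z by (simp add: center_def)
    have "bij_betw (\<lambda>y. y \<otimes> b) (?F \<one>) (?F z)"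
    proof (rule bij_betwI[of _ _ _ "\<lambda>y. y \<otimes> inv b"])
      show "(\<lambda>y. y \<otimes> b) \<in> ?F \<one> \<rightarrow> ?F z"
        using a b car zc by (auto simp: commutator_mult_right subgroup.m_closed[OF C])
      show "(\<lambda>y. y \<otimes> inv b) \<in> ?F z \<rightarrow> ?F \<one>"
        using a b car zc
        by (auto simp: commutator_mult_right commutator_inv_right subgroup.m_closed[OF C]
            subgroup.m_inv_closed[OF C])
    qed (use b car in \<open>auto simp: m_assoc\<close>)
    thus ?thesis by (simp add: bij_betw_same_card)
  qed
  have "C = (\<Union>z\<in>center G. ?F z)"
    using a car commutator_central by auto
  also have "card \<dots> = (\<Sum>z\<in>center G. card (?F z))"
    using finC finite_carrier by (intro card_UN_disjoint) (auto simp: center_def)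
  also have "\<dots> = p * card (?F \<one>)"
    using fib card_center by simp
  finally show ?thesis using fib[OF z] by (simp add: mult.commute)
qed

end

section \<open>Symplectic frames\<close>

definition orthogonal_pairs :: "('a, 'm) monoid_scheme \<Rightarrow> 'a \<times> 'a \<Rightarrow> 'a \<times> 'a \<Rightarrow> bool" where
  "orthogonal_pairs G = (\<lambda>(a, b) (a', b').
     commutator G a a' = \<one>\<^bsub>G\<^esub> \<and> commutator G a b' = \<one>\<^bsub>G\<^esub> \<and>
     commutator G b a' = \<one>\<^bsub>G\<^esub> \<and> commutator G b b' = \<one>\<^bsub>G\<^esub>)"

text \<open>
  Modulo the centre these are hyperbolic bases, scaled so that each pair has the value \<open>c\<close>. They are
  lists so that the first pair can be split off; \<open>sorted_wrt\<close> compares each pair only with later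
  ones, which suffices because \<open>[y, x]\<close> is the inverse of \<open>[x, y]\<close>.
\<close>

definition frames :: "('a, 'm) monoid_scheme \<Rightarrow> 'a \<Rightarrow> 'a set \<Rightarrow> nat \<Rightarrow> ('a \<times> 'a) list set" where
  "frames G c C m = {ps. length ps = m \<and> set ps \<subseteq> C \<times> C \<and>
     (\<forall>(a, b)\<in>set ps. commutator G a b = c) \<and> sorted_wrt (orthogonal_pairs G) ps}"

definition pair_centralizer :: "('a, 'm) monoid_scheme \<Rightarrow> 'a set \<Rightarrow> 'a \<Rightarrow> 'a \<Rightarrow> 'a set" where
  "pair_centralizer G C a b =
     {x \<in> C. commutator G a x = \<one>\<^bsub>G\<^esub> \<and> commutator G b x = \<one>\<^bsub>G\<^esub>}"

text \<open>
  The commutator pairing on \<open>C\<close> has radical exactly the centre of \<open>G\<close>. This is the invariant that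
  survives the passage to the centralizer of a hyperbolic pair.
\<close>

definition nondegenerate :: "('a, 'm) monoid_scheme \<Rightarrow> 'a set \<Rightarrow> bool" where
  "nondegenerate G C \<longleftrightarrow> subgroup C G \<and> center G \<subseteq> C \<and>
     (\<forall>x\<in>C. (\<forall>y\<in>C. commutator G x y = \<one>\<^bsub>G\<^esub>) \<longrightarrow> x \<in> center G)"

lemma frames_0: "frames G c C 0 = {[]}"
  by (auto simp: frames_def)

lemma frames_Cons:
  "(a, b) # ps \<in> frames G c C (Suc m) \<longleftrightarrow>
     a \<in> C \<and> b \<in> C \<and> commutator G a b = c \<and> ps \<in> frames G c (pair_centralizer G C a b) m"
  by (auto simp: frames_def pair_centralizer_def orthogonal_pairs_def)

lemma finite_frames: "finite C \<Longrightarrow> finite (frames G c C m)"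
  by (rule finite_subset[OF _ finite_lists_length_eq[of "C \<times> C" m]]) (auto simp: frames_def)

context prime_center_group
begin

lemma subgroup_pair_centralizer:
  assumes "subgroup C G" "a \<in> carrier G" "b \<in> carrier G"
  shows "subgroup (pair_centralizer G C a b) G"
proof -
  interpret C: subgroup C G by fact
  have "\<one> \<in> pair_centralizer G C a b" using assms(2,3) by (simp add: pair_centralizer_def)
  hence "pair_centralizer G C a b \<noteq> {}" by blast
  thus ?thesis
    using assms(2,3)
    by (intro subgroupI)
       (auto simp: pair_centralizer_def commutator_mult_right commutator_inv_right)
qed

text \<open>
  Orthogonal projection: powers of \<open>b\<close> and \<open>a\<close> correct \<open>[a, x]\<close> and \<open>[b, x]\<close> independently, since
  \<open>[a, a]\<close> and \<open>[b, b]\<close> are trivial while \<open>[a, b]\<close> generates the centre. Hence \<open>C\<close> is the product of the pair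
  centralizer and the subgroup generated by \<open>a\<close> and \<open>b\<close>.
\<close>

lemma pair_decomposition:
  assumes C: "subgroup C G" and ab: "a \<in> C" "b \<in> C"
    and c: "commutator G a b \<noteq> \<one>" and x: "x \<in> C"
  obtains y k l where "y \<in> pair_centralizer G C a b" "x = y \<otimes> b [^] (k::nat) \<otimes> a [^] (l::nat)"
proof -
  interpret C: subgroup C G by fact
  have car: "a \<in> carrier G" "b \<in> carrier G" "x \<in> carrier G" using ab x by auto
  have ba: "commutator G b a \<noteq> \<one>"
    using c car commutator_swap[of b a] by auto
  obtain k :: nat where k: "commutator G a x = commutator G a b [^] k"
    using center_power[OF commutator_central c commutator_central] car by metis
  obtain l :: nat where l: "commutator G b x = commutator G b a [^] l"
    using center_power[OF commutator_central ba commutator_central] car by metis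
  have pow: "u [^] n \<in> C" if "u \<in> C" for u and n :: nat
    using that by (induction n) auto
  define y where "y = x \<otimes> inv (a [^] l) \<otimes> inv (b [^] k)"
  have "y \<in> C" using ab x pow by (simp add: y_def)
  moreover have "commutator G a y = \<one>" "commutator G b y = \<one>"
    using car k l
    by (simp_all add: y_def commutator_mult_right commutator_inv_right commutator_pow_right)
  moreover have "x = y \<otimes> b [^] k \<otimes> a [^] l"
    using car by (simp add: y_def m_assoc)
  ultimately show thesis using that unfolding pair_centralizer_def by blast
qed

text \<open>
  Each of the two conditions defining the pair centralizer cuts the order by a factor \<open>p\<close>. The
  second is independent of the first because \<open>a\<close> commutes with itself but not with \<open>b\<close>.
\<close>

lemma card_pair_centralizer:
  assumes C: "subgroup C G" and ab: "a \<in> C" "b \<in> C" and c: "commutator G a b \<noteq> \<one>"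
  shows "card (pair_centralizer G C a b) * p * p = card C"
proof -
  interpret C: subgroup C G by fact
  let ?D = "{x \<in> C. commutator G a x = \<one>}"
  have car: "a \<in> carrier G" "b \<in> carrier G" using ab by auto
  have "\<one> \<in> ?D" using car by simp
  hence "?D \<noteq> {}" by blast
  hence D: "subgroup ?D G"
    using car by (intro subgroupI) (auto simp: commutator_mult_right commutator_inv_right)
  have one: "\<one> \<in> center G" using subgroup.one_closed[OF center_subgroup] .
  have "commutator G b a \<noteq> \<one>" using c car commutator_swap[of b a] by auto
  with D ab car have "card {x \<in> ?D. commutator G b x = \<one>} * p = card ?D"
    by (intro card_commutator_fibre[OF D _ _ _ one, of _ a]) auto
  moreover have "card ?D * p = card C"
    using card_commutator_fibre[OF C car(1) ab(2) c one] .
  moreover have "{x \<in> ?D. commutator G b x = \<one>} = pair_centralizer G C a b"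
    by (auto simp: pair_centralizer_def)
  ultimately show ?thesis by simp
qed

text \<open>
  An element of the pair centralizer that commutes with all of it also commutes with \<open>a\<close> and \<open>b\<close>,
  hence with all of \<open>C\<close> by \<open>pair_decomposition\<close>.
\<close>

lemma nondegenerate_pair_centralizer:
  assumes C: "nondegenerate G C" and ab: "a \<in> C" "b \<in> C" and c: "commutator G a b \<noteq> \<one>"
  shows "nondegenerate G (pair_centralizer G C a b)"
proof -
  have sub: "subgroup C G" and Z: "center G \<subseteq> C"
    using C by (auto simp: nondegenerate_def)
  interpret C: subgroup C G by fact
  have car: "a \<in> carrier G" "b \<in> carrier G" using ab by auto
  have "x \<in> center G" if x: "x \<in> pair_centralizer G C a b"
      and comm: "\<And>y. y \<in> pair_centralizer G C a b \<Longrightarrow> commutator G x y = \<one>" for x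
  proof -
    have xC: "x \<in> C" and xc: "x \<in> carrier G" using x by (auto simp: pair_centralizer_def)
    have xab: "commutator G x a = \<one>" "commutator G x b = \<one>"
      using x xc car commutator_swap[of a x] commutator_swap[of b x]
      by (auto simp: pair_centralizer_def)
    have "commutator G x u = \<one>" if u: "u \<in> C" for u
    proof -
      obtain y k l where y: "y \<in> pair_centralizer G C a b"
        and ueq: "u = y \<otimes> b [^] (k::nat) \<otimes> a [^] (l::nat)"
        using pair_decomposition[OF sub ab c u] .
      have "y \<in> carrier G" using y by (auto simp: pair_centralizer_def)
      thus ?thesis using comm[OF y] xab xc car
        by (simp add: ueq commutator_mult_right commutator_pow_right)
    qed
    thus ?thesis using C xC by (auto simp: nondegenerate_def)
  qed
  moreover have "center G \<subseteq> pair_centralizer G C a b"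
    using Z car by (auto simp: pair_centralizer_def)
  ultimately show ?thesis
    using subgroup_pair_centralizer[OF sub car] by (auto simp: nondegenerate_def)
qed

text \<open>
  Exactly the elements \<open>a\<close> outside the centre occur as first entries, and by
  \<open>card_commutator_fibre\<close> each of them has \<open>|C|/p\<close> partners.
\<close>

lemma card_hyperbolic_pairs:
  assumes C: "nondegenerate G C" and card_C: "card C = p ^ (2 * m + 3)"
    and c: "c \<in> center G" "c \<noteq> \<one>"
  shows "card {(a, b). a \<in> C \<and> b \<in> C \<and> commutator G a b = c} =
    p ^ (2 * m + 3) * (p ^ (2 * m + 2) - 1)"
proof -
  have sub: "subgroup C G" and Z: "center G \<subseteq> C"
    using C by (auto simp: nondegenerate_def)
  interpret C: subgroup C G by fact
  have finC: "finite C" using finite_carrier C.subset finite_subset by blast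
  have p0: "p > 0" using prime prime_gt_0_nat by blast
  have fib: "card {b \<in> C. commutator G a b = c} = p ^ (2 * m + 2)" if a: "a \<in> C - center G" for a
  proof -
    have ac: "a \<in> carrier G" using a by auto
    obtain x where "x \<in> C" "commutator G a x \<noteq> \<one>"
      using C a by (auto simp: nondegenerate_def)
    hence "card {b \<in> C. commutator G a b = c} * p = card C"
      using card_commutator_fibre[OF sub ac] c by blast
    moreover have "card C = p ^ (2 * m + 2) * p"
      by (simp add: card_C eval_nat_numeral mult_ac)
    ultimately show ?thesis using p0 by simp
  qed
  have "commutator G a b \<noteq> c" if "a \<in> center G" "b \<in> C" for a b
    using that c(2) mem_center_iff[of a] by auto
  hence "{(a, b). a \<in> C \<and> b \<in> C \<and> commutator G a b = c} =
      (SIGMA a:C - center G. {b \<in> C. commutator G a b = c})"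
    by auto
  also have "card \<dots> = (\<Sum>a\<in>C - center G. card {b \<in> C. commutator G a b = c})"
    using finC by (intro card_SigmaI) auto
  also have "\<dots> = (card C - p) * p ^ (2 * m + 2)"
    using fib card_Diff_subset[OF finite_subset[OF Z finC] Z] card_center by simp
  also have "\<dots> = p ^ (2 * m + 3) * (p ^ (2 * m + 2) - 1)"
  proof -
    define q where "q = p ^ (2 * m + 2)"
    have "p ^ (2 * m + 3) = p * q" by (simp add: q_def eval_nat_numeral)
    thus ?thesis unfolding card_C q_def[symmetric]
      by (simp add: diff_mult_distrib diff_mult_distrib2 mult_ac)
  qed
  finally show ?thesis .
qed

text \<open>
  The induction removes the first pair and continues in its centralizer. The exponents add up as
  \<open>m(m + 2) + (2m + 3) = (m + 1)(m + 3)\<close>.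
\<close>

lemma card_frames:
  assumes "nondegenerate G C" "card C = p ^ (2 * m + 1)" and c: "c \<in> center G" "c \<noteq> \<one>"
  shows "card (frames G c C m) = p ^ (m * (m + 2)) * (\<Prod>i = 1..m. p ^ (2 * i) - 1)"
  using assms(1,2)
proof (induction m arbitrary: C)
  case 0
  thus ?case by (simp add: frames_0)
next
  case (Suc m)
  let ?P = "{(a, b). a \<in> C \<and> b \<in> C \<and> commutator G a b = c}"
  let ?N = "p ^ (m * (m + 2)) * (\<Prod>i = 1..m. p ^ (2 * i) - 1)"
  have sub: "subgroup C G" using Suc.prems(1) by (simp add: nondegenerate_def)
  have finC: "finite C" using finite_carrier subgroup.subset[OF sub] finite_subset by blast
  have p0: "p > 0" using prime prime_gt_0_nat by blast
  have card_C: "card C = p ^ (2 * m + 3)" using Suc.prems(2) by (simp add: numeral_3_eq_3)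
  have rest: "card (frames G c (pair_centralizer G C a b) m) = ?N"
    if ab: "a \<in> C" "b \<in> C" "commutator G a b = c" for a b
  proof (rule Suc.IH)
    have nz: "commutator G a b \<noteq> \<one>" using ab c by simp
    show "nondegenerate G (pair_centralizer G C a b)"
      using nondegenerate_pair_centralizer[OF Suc.prems(1) ab(1,2) nz] .
    show "card (pair_centralizer G C a b) = p ^ (2 * m + 1)"
      using card_pair_centralizer[OF sub ab(1,2) nz] Suc.prems(2) p0 by simp
  qed
  let ?S = "SIGMA ab:?P. frames G c (pair_centralizer G C (fst ab) (snd ab)) m"
  have "frames G c C (Suc m) = (\<lambda>(ab, ps). ab # ps) ` ?S"
  proof (intro equalityI subsetI)
    fix qs assume qs: "qs \<in> frames G c C (Suc m)"
    then obtain a b ps where "qs = (a, b) # ps"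
      by (cases qs) (auto simp: frames_def)
    thus "qs \<in> (\<lambda>(ab, ps). ab # ps) ` ?S"
      using qs by (auto simp: frames_Cons intro!: image_eqI[of _ _ "((a, b), ps)"])
  qed (auto simp: frames_Cons)
  moreover have "inj_on (\<lambda>(ab, ps). ab # ps) ?S" by (auto simp: inj_on_def)
  ultimately have "card (frames G c C (Suc m)) = card ?S"
    by (simp add: card_image)
  also have "\<dots> = (\<Sum>ab\<in>?P. card (frames G c (pair_centralizer G C (fst ab) (snd ab)) m))"
  proof (rule card_SigmaI)
    show "finite ?P" by (rule finite_subset[of _ "C \<times> C"]) (use finC in auto)
    show "\<forall>ab\<in>?P. finite (frames G c (pair_centralizer G C (fst ab) (snd ab)) m)"
      using finC by (auto intro!: finite_frames simp: pair_centralizer_def)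
  qed
  also have "\<dots> = (\<Sum>ab\<in>?P. ?N)"
    using rest by (intro sum.cong) auto
  also have "\<dots> = p ^ (2 * m + 3) * (p ^ (2 * m + 2) - 1) * ?N"
    using card_hyperbolic_pairs[OF Suc.prems(1) _ c, of m] card_C
    by simp
  also have "\<dots> = p ^ (2 * m + 3 + m * (m + 2)) *
      ((\<Prod>i = 1..m. p ^ (2 * i) - 1) * (p ^ (2 * Suc m) - 1))"
  proof -
    have reorder: "a * x * (b * y) = (a * b) * (y * x)" for a b x y :: nat by simp
    have e: "2 * Suc m = 2 * m + 2" by simp
    show ?thesis unfolding e power_add[of p "2 * m + 3" "m * (m + 2)"] by (rule reorder)
  qed
  also have "\<dots> = p ^ (Suc m * (Suc m + 2)) * (\<Prod>i = 1..Suc m. p ^ (2 * i) - 1)"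
  proof -
    have "2 * m + 3 + m * (m + 2) = Suc m * (Suc m + 2)" by simp
    moreover have "(\<Prod>i = 1..Suc m. p ^ (2 * i) - 1) = (\<Prod>i = 1..m. p ^ (2 * i) - 1) * (p ^ (2 * Suc m) - 1)"
      by (simp add: prod.cl_ivl_Suc del: mult_Suc_right)
    ultimately show ?thesis by (simp only:)
  qed
  finally show ?case .
qed

text \<open>
  The induction descends to the centre itself, a group of order \<open>p\<close> that \<open>c\<close> generates; on the way
  back \<open>pair_decomposition\<close> recovers \<open>C\<close> from the first pair and its centralizer.
\<close>

lemma frame_generates:
  assumes "nondegenerate G C" "card C = p ^ (2 * m + 1)" and c: "c \<in> center G" "c \<noteq> \<one>"
    and "ps \<in> frames G c C m" and K: "subgroup K G" "c \<in> K" "set ps \<subseteq> K \<times> K"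
  shows "C \<subseteq> K"
  using assms(1,2,5,8)
proof (induction m arbitrary: C ps)
  have pow: "u [^] n \<in> K" if "u \<in> K" for u and n :: nat
    using that K by (induction n) (auto simp: subgroup.one_closed subgroup.m_closed)
  {
    case 0
    have "center G = C"
    proof (rule card_subset_eq)
      show "finite C" using 0 prime by (intro card_ge_0_finite) (simp add: prime_gt_0_nat)
    qed (use 0 card_center in \<open>auto simp: nondegenerate_def\<close>)
    thus ?case using center_power[OF c] pow[OF K(2)] by (metis subsetI)
  next
    case (Suc m)
    then obtain a b qs where ps: "ps = (a, b) # qs"
      by (cases ps) (auto simp: frames_def)
    have sub: "subgroup C G" using Suc.prems(1) by (simp add: nondegenerate_def)
    have ab: "a \<in> C" "b \<in> C" "commutator G a b = c"
      and qs: "qs \<in> frames G c (pair_centralizer G C a b) m"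
      using Suc.prems(3) by (auto simp: ps frames_Cons)
    have abK: "a \<in> K" "b \<in> K" and qsK: "set qs \<subseteq> K \<times> K" using Suc.prems(4) ps by auto
    have nz: "commutator G a b \<noteq> \<one>" using ab c by simp
    have "card (pair_centralizer G C a b) = p ^ (2 * m + 1)"
      using card_pair_centralizer[OF sub ab(1,2) nz] Suc.prems(2) prime by (simp add: prime_gt_0_nat)
    from Suc.IH[OF nondegenerate_pair_centralizer[OF Suc.prems(1) ab(1,2) nz] this qs qsK]
    have "pair_centralizer G C a b \<subseteq> K" .
    thus ?case
      using pair_decomposition[OF sub ab(1,2) nz] pow abK
      by (metis subgroup.m_closed[OF K(1)] subsetD subsetI)
  }
qed

lemma nondegenerate_carrier: "nondegenerate G (carrier G)"
  by (auto simp: nondegenerate_def subgroup_self mem_center_iff)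

end

section \<open>Admissible epimorphisms and frames\<close>

text \<open>
  With \<open>|G| = 2k + 1\<close>, every element \<open>x = x\<^bsup>|G| + 1\<^esup> = (x\<^sup>2)\<^bsup>k + 1\<^esup>\<close> is a power of its square. This
  yields that \<open>\<phi>(\<sigma>)\<close> is central, and also that \<open>\<phi>(\<sigma>)\<^sup>2 \<noteq> 1\<close> if \<open>\<phi>(\<sigma>) \<noteq> 1\<close>.
\<close>

lemma (in group) mem_subgroup_if_square_mem:
  assumes "finite (carrier G)" "odd (order G)" "x \<in> carrier G"
    and "subgroup K G" "x \<otimes> x \<in> K"
  shows "x \<in> K"
proof -
  obtain k where k: "order G = 2 * k + 1" using assms(2) oddE by blast
  have "(x \<otimes> x) [^] n \<in> K" for n :: nat
    using assms(4,5) by (induction n) (auto simp: subgroup.one_closed subgroup.m_closed)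
  moreover have "(x \<otimes> x) [^] (k + 1) = x"
  proof -
    have "x \<otimes> x = x [^] (2::nat)" using assms(3) by (simp add: numeral_2_eq_2)
    hence "(x \<otimes> x) [^] (k + 1) = x [^] (order G + 1)"
      using assms(3) by (simp only: nat_pow_pow) (simp add: k)
    thus ?thesis using pow_order_eq_1[OF assms(3)] assms(3) by simp
  qed
  ultimately show ?thesis by metis
qed

definition generator_pairs :: "nat \<Rightarrow> (braid_gen \<Rightarrow> 'a) \<Rightarrow> ('a \<times> 'a) list" where
  "generator_pairs g f = map (\<lambda>i. (f (GenA (Suc i)), f (GenB (Suc i)))) [0..<g]"

text \<open>Translates between list positions, which start at 0, and the indices \<open>1, \<dots>, g\<close> of the generators.\<close>

lemma generator_pairs_in_frames_iff:
  assumes "f \<in> braid_gens g \<rightarrow> carrier G"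
  shows "generator_pairs g f \<in> frames G c (carrier G) g \<longleftrightarrow>
    (\<forall>i\<in>{1..g}. commutator G (f (GenA i)) (f (GenB i)) = c) \<and>
    (\<forall>i j. 1 \<le> j \<longrightarrow> j < i \<longrightarrow> i \<le> g \<longrightarrow>
       orthogonal_pairs G (f (GenA j), f (GenB j)) (f (GenA i), f (GenB i)))"
proof -
  let ?orth = "\<lambda>j i. orthogonal_pairs G (f (GenA j), f (GenB j)) (f (GenA i), f (GenB i))"
  have "set (generator_pairs g f) \<subseteq> carrier G \<times> carrier G"
    using assms by (auto simp: generator_pairs_def braid_gens_def)
  moreover have "(\<forall>(a, b)\<in>set (generator_pairs g f). commutator G a b = c) \<longleftrightarrow>
      (\<forall>i\<in>{1..g}. commutator G (f (GenA i)) (f (GenB i)) = c)"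
  proof -
    have "{1..g} = Suc ` {0..<g}" by (simp add: image_Suc_atLeastLessThan atLeastLessThanSuc_atLeastAtMost)
    thus ?thesis by (simp only: generator_pairs_def set_map set_upt ball_simps prod.case)
  qed
  moreover have "sorted_wrt (orthogonal_pairs G) (generator_pairs g f) \<longleftrightarrow>
      (\<forall>i j. 1 \<le> j \<longrightarrow> j < i \<longrightarrow> i \<le> g \<longrightarrow> ?orth j i)"
  proof -
    have "sorted_wrt (orthogonal_pairs G) (generator_pairs g f) \<longleftrightarrow>
        (\<forall>j i. j < i \<longrightarrow> i < g \<longrightarrow> ?orth (Suc j) (Suc i))"
      by (auto simp: generator_pairs_def sorted_wrt_iff_nth_less)
    also have "\<dots> \<longleftrightarrow> (\<forall>i j. 1 \<le> j \<longrightarrow> j < i \<longrightarrow> i \<le> g \<longrightarrow> ?orth j i)"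
    proof (intro iffI allI impI)
      fix i j assume "\<forall>j i. j < i \<longrightarrow> i < g \<longrightarrow> ?orth (Suc j) (Suc i)" "1 \<le> j" "j < i" "i \<le> g"
      thus "?orth j i" by (cases i; cases j) simp_all
    qed auto
    finally show ?thesis .
  qed
  ultimately show ?thesis by (simp add: frames_def) (simp add: generator_pairs_def)
qed

context prime_center_group
begin

lemma commutator_central_factor:
  assumes "x \<in> carrier G" "y \<in> carrier G" "z \<in> center G" "z' \<in> center G"
  shows "commutator G x (z \<otimes> (y \<otimes> z')) = commutator G x y"
  using assms by (simp add: commutator_mult_right center_imp_carrier)

lemma orthogonal_pairs_swap:
  assumes "a \<in> carrier G" "b \<in> carrier G" "a' \<in> carrier G" "b' \<in> carrier G"
  shows "orthogonal_pairs G (a', b') (a, b) \<longleftrightarrow>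
    commutator G a a' = \<one> \<and> commutator G a b' = \<one> \<and>
    commutator G b a' = \<one> \<and> commutator G b b' = \<one>"
  using assms commutator_swap[of a a'] commutator_swap[of a b']
    commutator_swap[of b a'] commutator_swap[of b b']
  by (auto simp: orthogonal_pairs_def)

lemma word_value_concat_const:
  assumes f: "f \<in> S \<rightarrow> carrier G" and d: "d \<in> carrier G"
    and "\<And>i. i \<in> set is \<Longrightarrow> w i \<in> words S \<and> word_value G f (w i) = d"
  shows "word_value G f (concat (map w is)) = d [^] length is"
  using assms(3)
proof (induction "is")
  case (Cons i "is")
  have "concat (map w is) \<in> words S" using Cons.prems by (intro concat_in_words) auto
  thus ?case using Cons d nat_pow_Suc2[OF d] by (simp add: word_value_append[OF f])
qed simp

text \<open>
  Once the image of \<open>\<sigma>\<close> is central, conjugating or multiplying by it does not change a commutator.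
  The relations \<open>[a\<^sub>i, a\<^sub>i] = [b\<^sub>i, b\<^sub>i] = 1\<close> become void, the other commutator relations describe a frame, and the
  surface relation turns into a condition on the order of \<open>t = \<phi>(\<sigma>)\<^sup>2\<close>, namely \<open>t\<^bsup>-g\<^esup> = t\<close>.
\<close>

lemma respects_braid_rels_iff_central:
  assumes odd: "odd (order G)" and f: "f \<in> braid_gens g \<rightarrow> carrier G"
    and s: "f GenS \<in> center G" "f GenS \<noteq> \<one>"
  shows "(\<forall>(l, r)\<in>braid_rels g. word_value G f l = word_value G f r) \<longleftrightarrow>
    generator_pairs g f \<in> frames G (f GenS \<otimes> f GenS) (carrier G) g \<and> p dvd g + 1"
proof -
  let ?s = "f GenS" and ?a = "\<lambda>i. f (GenA i)" and ?b = "\<lambda>i. f (GenB i)"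
  let ?t = "?s \<otimes> ?s"
  let ?prod = "concat (map (\<lambda>i. comm_word (a_word i) (inv_word (b_word i))) [1..<Suc g])"
  have sc: "?s \<in> carrier G" using s(1) by (rule center_imp_carrier)
  have si: "inv ?s \<in> center G" using subgroup.m_inv_closed[OF center_subgroup s(1)] .
  have ab: "?a i \<in> carrier G" "?b i \<in> carrier G" if "i \<in> {1..g}" for i
    using f that by (auto simp: braid_gens_def)
  have S: "GenS \<in> braid_gens g" by (simp add: braid_gens_def)
  have AB: "GenA i \<in> braid_gens g" "GenB i \<in> braid_gens g" if "i \<in> {1..g}" for i
    using that by (auto simp: braid_gens_def)
  have conj1: "word_value G f (comm_word (gen_word x) (inv_word s_word @ gen_word y @ inv_word s_word)) =
      commutator G (f x) (f y)"
    and conj2: "word_value G f (comm_word (gen_word x) (inv_word s_word @ gen_word y @ s_word)) =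
      commutator G (f x) (f y)"
    if "x \<in> braid_gens g" "y \<in> braid_gens g" for x y
    using that S s si funcset_mem[OF f]
    by (simp_all add: word_value_comm[OF f] word_value_append[OF f] word_value_inv[OF f]
        word_value_gen[OF f] commutator_central_factor)
  have t: "word_value G f (s_word @ s_word) = ?t"
    using S by (simp add: word_value_append[OF f] word_value_gen[OF f])
  have tc: "?t \<in> center G" using subgroup.m_closed[OF center_subgroup s(1) s(1)] .
  have t1: "?t \<noteq> \<one>"
    using mem_subgroup_if_square_mem[OF finite_carrier odd sc triv_subgroup] s(2) by auto
  have prod: "word_value G f ?prod = ?t \<longleftrightarrow> p dvd g + 1"
    if hyp: "\<forall>i\<in>{1..g}. commutator G (?a i) (?b i) = ?t"
  proof -
    have "word_value G f ?prod = inv ?t [^] length [1..<Suc g]"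
    proof (rule word_value_concat_const[OF f])
      fix i assume "i \<in> set [1..<Suc g]"
      hence i: "i \<in> {1..g}" by auto
      show "comm_word (a_word i) (inv_word (b_word i)) \<in> words (braid_gens g) \<and>
          word_value G f (comm_word (a_word i) (inv_word (b_word i))) = inv ?t"
        using hyp i ab[OF i] AB[OF i]
        by (simp add: word_value_comm[OF f] word_value_inv[OF f] word_value_gen[OF f]
            commutator_inv_right)
    qed (use sc in simp)
    hence "word_value G f ?prod = inv (?t [^] g)"
      using sc by (simp add: nat_pow_inv del: upt_Suc)
    moreover have "inv (?t [^] g) = ?t \<longleftrightarrow> ?t [^] (g + 1) = \<one>"
    proof -
      have Tc: "?t \<in> carrier G" "?t [^] g \<in> carrier G" using sc by auto
      have "inv (?t [^] g) = ?t \<longleftrightarrow> ?t \<otimes> ?t [^] g = \<one>"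
        using l_inv[OF Tc(2)] inv_equality[OF _ Tc(2,1)] by auto
      thus ?thesis using nat_pow_Suc2[OF Tc(1)] by (simp only: Suc_eq_plus1[symmetric])
    qed
    ultimately show ?thesis
      using sc pow_eq_id[of ?t "g + 1"] ord_center[OF tc t1] by simp
  qed
  have "(\<forall>(l, r)\<in>braid_rels g. word_value G f l = word_value G f r) \<longleftrightarrow>
     (\<forall>i\<in>{1..g}. commutator G (?a i) (?a i) = \<one>) \<and>
     (\<forall>i\<in>{1..g}. commutator G (?b i) (?b i) = \<one>) \<and>
     (\<forall>i j. 1 \<le> j \<longrightarrow> j < i \<longrightarrow> i \<le> g \<longrightarrow> commutator G (?a i) (?a j) = \<one>) \<and>
     (\<forall>i j. 1 \<le> j \<longrightarrow> j < i \<longrightarrow> i \<le> g \<longrightarrow> commutator G (?a i) (?b j) = \<one>) \<and>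
     (\<forall>i j. 1 \<le> j \<longrightarrow> j < i \<longrightarrow> i \<le> g \<longrightarrow> commutator G (?b i) (?a j) = \<one>) \<and>
     (\<forall>i j. 1 \<le> j \<longrightarrow> j < i \<longrightarrow> i \<le> g \<longrightarrow> commutator G (?b i) (?b j) = \<one>) \<and>
     (\<forall>i\<in>{1..g}. commutator G (?a i) (?b i) = ?t) \<and>
     word_value G f ?prod = ?t"
  proof -
    have family: "(\<forall>(l, r)\<in>{(L i, v) |i. i \<in> I}. Q l r) \<longleftrightarrow> (\<forall>i\<in>I. Q (L i) v)"
      for L :: "nat \<Rightarrow> braid_gen word" and v :: "braid_gen word" and I Q
      by blast
    have family2: "(\<forall>(l, r)\<in>{(L i j, v) |i j. P i j}. Q l r) \<longleftrightarrow> (\<forall>i j. P i j \<longrightarrow> Q (L i j) v)"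
      for L :: "nat \<Rightarrow> nat \<Rightarrow> braid_gen word" and v :: "braid_gen word" and P Q
      by blast
    have rel: "(\<forall>(l, r)\<in>{(comm_word (gen_word (x i)) (inv_word s_word @ gen_word (y i) @ inv_word s_word), v) |i.
          i \<in> {1..g}}. word_value G f l = word_value G f r) \<longleftrightarrow>
        (\<forall>i\<in>{1..g}. commutator G (f (x i)) (f (y i)) = word_value G f v)"
      if "x \<in> {GenA, GenB}" "y \<in> {GenA, GenB}" for x y v
      unfolding family using conj1 that AB by (intro ball_cong) auto
    have rel2: "(\<forall>(l, r)\<in>{(comm_word (gen_word (x i)) (inv_word s_word @ gen_word (y j) @ s_word), []) |i j.
          1 \<le> j \<and> j < i \<and> i \<le> g}. word_value G f l = word_value G f r) \<longleftrightarrow>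
        (\<forall>i j. 1 \<le> j \<longrightarrow> j < i \<longrightarrow> i \<le> g \<longrightarrow> commutator G (f (x i)) (f (y j)) = \<one>)"
      if xy: "x \<in> {GenA, GenB}" "y \<in> {GenA, GenB}" for x y
    proof -
      have "word_value G f (comm_word (gen_word (x i)) (inv_word s_word @ gen_word (y j) @ s_word)) =
          commutator G (f (x i)) (f (y j))" if "1 \<le> j" "j < i" "i \<le> g" for i j
        using xy AB that by (intro conj2) auto
      thus ?thesis unfolding family2 by auto
    qed
    have A: "GenA \<in> {GenA, GenB}" and B: "GenB \<in> {GenA, GenB}" by simp_all
    have last: "(\<forall>(l, r)\<in>{(?prod, s_word @ s_word)}. word_value G f l = word_value G f r) \<longleftrightarrow>
        word_value G f ?prod = ?t"
      using t by simp
    show ?thesis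
      unfolding braid_rels_def ball_Un rel[OF A A] rel[OF B B] rel[OF A B]
        rel2[OF A A] rel2[OF A B] rel2[OF B A] rel2[OF B B] last
      by (simp only: word_value_Nil t conj_assoc)
  qed
  also have "\<dots> \<longleftrightarrow> (\<forall>i\<in>{1..g}. commutator G (?a i) (?b i) = ?t) \<and>
     (\<forall>i j. 1 \<le> j \<longrightarrow> j < i \<longrightarrow> i \<le> g \<longrightarrow> orthogonal_pairs G (?a j, ?b j) (?a i, ?b i)) \<and>
     p dvd g + 1"
  proof -
    have "orthogonal_pairs G (?a j, ?b j) (?a i, ?b i) \<longleftrightarrow>
        commutator G (?a i) (?a j) = \<one> \<and> commutator G (?a i) (?b j) = \<one> \<and>
        commutator G (?b i) (?a j) = \<one> \<and> commutator G (?b i) (?b j) = \<one>"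
      if "1 \<le> j" "j < i" "i \<le> g" for i j
      using orthogonal_pairs_swap ab that by simp
    thus ?thesis using prod ab commutator_self by blast
  qed
  finally show ?thesis using generator_pairs_in_frames_iff[OF f] by simp
qed

text \<open>
  That the image of \<open>\<sigma>\<close> is central is a consequence of the relation
  \<open>[a\<^sub>1, \<sigma>\<inverse> b\<^sub>1 \<sigma>\<inverse>] = \<sigma>\<^sup>2\<close>, which makes its square a commutator.
\<close>

lemma respects_braid_rels_iff:
  assumes odd: "odd (order G)" and f: "f \<in> braid_gens g \<rightarrow> carrier G"
    and s: "f GenS \<noteq> \<one>" and g: "g \<ge> 1"
  shows "(\<forall>(l, r)\<in>braid_rels g. word_value G f l = word_value G f r) \<longleftrightarrow>
    f GenS \<in> center G \<and> generator_pairs g f \<in> frames G (f GenS \<otimes> f GenS) (carrier G) g \<and> p dvd g + 1"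
proof -
  have "f GenS \<in> center G" if R: "\<forall>(l, r)\<in>braid_rels g. word_value G f l = word_value G f r"
  proof -
    let ?u = "inv_word s_word @ b_word 1 @ inv_word s_word"
    have S: "GenS \<in> braid_gens g" "GenA 1 \<in> braid_gens g" "GenB 1 \<in> braid_gens g"
      using g by (auto simp: braid_gens_def)
    have sc: "f GenS \<in> carrier G" using f S(1) by auto
    have "(comm_word (a_word 1) ?u, s_word @ s_word) \<in> braid_rels g"
      using g unfolding braid_rels_def by fastforce
    with R have "word_value G f (comm_word (a_word 1) ?u) = word_value G f (s_word @ s_word)" by blast
    hence "commutator G (word_value G f (a_word 1)) (word_value G f ?u) = f GenS \<otimes> f GenS"
      using S by (simp add: word_value_comm[OF f] word_value_append[OF f] word_value_gen[OF f])
    moreover have "commutator G (word_value G f (a_word 1)) (word_value G f ?u) \<in> center G"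
      using S by (intro commutator_central word_value_closed[OF f]) simp_all
    ultimately show ?thesis
      using mem_subgroup_if_square_mem[OF finite_carrier odd sc center_subgroup] by simp
  qed
  thus ?thesis using respects_braid_rels_iff_central[OF odd f _ s] by blast
qed

lemma bij_betw_generator_pairs:
  fixes R :: "'a \<Rightarrow> ('a \<times> 'a) list set"
  assumes "\<And>s ps. ps \<in> R s \<Longrightarrow> length ps = g \<and> set ps \<subseteq> carrier G \<times> carrier G"
    and "Z \<subseteq> carrier G"
  shows "bij_betw (\<lambda>f. (f GenS, generator_pairs g f))
    {f \<in> braid_gens g \<rightarrow>\<^sub>E carrier G. f GenS \<in> Z \<and> generator_pairs g f \<in> R (f GenS)}
    (SIGMA s:Z. R s)"
proof -
  let ?inv = "\<lambda>(s, ps). \<lambda>x\<in>braid_gens g.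
    case x of GenA i \<Rightarrow> fst (ps ! (i - 1)) | GenB i \<Rightarrow> snd (ps ! (i - 1)) | GenS \<Rightarrow> s"
  have pairs: "generator_pairs g (?inv (s, ps)) = ps" if "length ps = g" for s ps
    using that by (intro nth_equalityI) (auto simp: generator_pairs_def braid_gens_def)
  have S: "?inv (s, ps) GenS = s" for s ps by (simp add: braid_gens_def)
  show ?thesis
  proof (rule bij_betwI[of _ _ _ ?inv])
    show "?inv \<in> (SIGMA s:Z. R s) \<rightarrow>
        {f \<in> braid_gens g \<rightarrow>\<^sub>E carrier G. f GenS \<in> Z \<and> generator_pairs g f \<in> R (f GenS)}"
    proof
      fix q assume "q \<in> (SIGMA s:Z. R s)"
      then obtain s ps where q: "q = (s, ps)" and s: "s \<in> Z" and ps: "ps \<in> R s" by auto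
      have len: "length ps = g" and sub: "set ps \<subseteq> carrier G \<times> carrier G"
        using assms(1)[OF ps] by auto
      have "ps ! (i - 1) \<in> carrier G \<times> carrier G" if "i \<in> {1..g}" for i
        using that len sub nth_mem[of "i - 1" ps] by (auto intro!: subsetD[OF sub])
      hence "?inv (s, ps) \<in> braid_gens g \<rightarrow>\<^sub>E carrier G"
        using s assms(2) by (auto simp: braid_gens_def mem_Times_iff)
      thus "?inv q \<in> {f \<in> braid_gens g \<rightarrow>\<^sub>E carrier G. f GenS \<in> Z \<and> generator_pairs g f \<in> R (f GenS)}"
        using s ps pairs[OF len, of s] S[of s ps] unfolding q mem_Collect_eq by presburger
    qed
    show "?inv (f GenS, generator_pairs g f) = f"
      if "f \<in> {f \<in> braid_gens g \<rightarrow>\<^sub>E carrier G. f GenS \<in> Z \<and> generator_pairs g f \<in> R (f GenS)}" for f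
    proof
      fix x show "?inv (f GenS, generator_pairs g f) x = f x"
        using that by (auto simp: generator_pairs_def braid_gens_def PiE_iff extensional_def
            split: braid_gen.splits)
    qed
    show "(?inv q GenS, generator_pairs g (?inv q)) = q" if elem: "q \<in> (SIGMA s:Z. R s)" for q
    proof -
      obtain s ps where q: "q = (s, ps)" and "ps \<in> R s" using elem by auto
      hence len: "length ps = g" using assms(1) by blast
      show ?thesis by (simp only: q S pairs[OF len])
    qed
  qed auto
qed

text \<open>
  Surjectivity comes for free: the image contains a frame of full length, and \<open>frame_generates\<close> applies.
\<close>

lemma admissible_epis_iff:
  assumes odd: "odd (order G)" and ord_G: "order G = p ^ (2 * g + 1)" and g: "g \<ge> 1"
    and \<phi>: "\<phi> \<in> hom (braid_group2 g) G" "\<phi> \<in> extensional (carrier (braid_group2 g))"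
  shows "\<phi> \<in> admissible_epis g G \<longleftrightarrow> \<phi> (braid_sigma g) \<noteq> \<one>"
proof -
  let ?S = "braid_gens g" and ?R = "braid_rels g"
  let ?f = "\<lambda>x\<in>?S. \<phi> (word_class ?S ?R (gen_word x))"
  have S: "GenS \<in> ?S" by (simp add: braid_gens_def)
  have sig: "braid_sigma g \<in> carrier (braid_group2 g)"
    using S by (auto simp: braid_sigma_def braid_group2_def carrier_presented_group)
  hence sc: "\<phi> (braid_sigma g) \<in> carrier G" using \<phi>(1) by (auto simp: hom_def)
  have ord: "2 \<le> ord (\<phi> (braid_sigma g)) \<longleftrightarrow> \<phi> (braid_sigma g) \<noteq> \<one>"
    using ord_ge_1[OF finite_carrier sc] ord_eq_1[OF sc] by linarith
  have "\<phi> ` carrier (braid_group2 g) = carrier G" if nz: "\<phi> (braid_sigma g) \<noteq> \<one>"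
  proof -
    interpret P: group "braid_group2 g" unfolding braid_group2_def by (rule group_presented_group)
    interpret h: group_hom "braid_group2 g" G \<phi> using \<phi>(1) by unfold_locales
    have fS: "?f GenS = \<phi> (braid_sigma g)" using S by (simp add: braid_sigma_def)
    have "?f \<in> {f \<in> ?S \<rightarrow>\<^sub>E carrier G. \<forall>(l, r)\<in>?R. word_value G f l = word_value G f r}"
      using bij_betwE[OF bij_betw_presented_homs[OF braid_rels_in_words[of g]]] \<phi>
      unfolding braid_group2_def by blast
    hence f: "?f \<in> ?S \<rightarrow> carrier G"
      and R: "\<forall>(l, r)\<in>?R. word_value G ?f l = word_value G ?f r"
      by (auto simp: PiE_iff)
    have "?f GenS \<noteq> \<one>" using nz fS by simp
    from respects_braid_rels_iff[OF odd f this g] R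
    have s: "?f GenS \<in> center G"
      and fr: "generator_pairs g ?f \<in> frames G (?f GenS \<otimes> ?f GenS) (carrier G) g"
      by blast+
    have t: "?f GenS \<otimes> ?f GenS \<in> center G" using subgroup.m_closed[OF center_subgroup s s] .
    have t1: "?f GenS \<otimes> ?f GenS \<noteq> \<one>"
      using mem_subgroup_if_square_mem[OF finite_carrier odd _ triv_subgroup, of "?f GenS"] nz fS sc
      by auto
    have K: "subgroup (\<phi> ` carrier (braid_group2 g)) G" by (rule h.img_is_subgroup)
    have fK: "?f x \<in> \<phi> ` carrier (braid_group2 g)" if "x \<in> ?S" for x
      using that by (auto simp: braid_group2_def carrier_presented_group)
    have "carrier G \<subseteq> \<phi> ` carrier (braid_group2 g)"
    proof (rule frame_generates[OF nondegenerate_carrier _ t t1 fr K])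
      show "card (carrier G) = p ^ (2 * g + 1)" using ord_G by (simp add: order_def)
      show "?f GenS \<otimes> ?f GenS \<in> \<phi> ` carrier (braid_group2 g)"
        using subgroup.m_closed[OF K] fK[OF S] by blast
      have "GenA (Suc i) \<in> ?S \<and> GenB (Suc i) \<in> ?S" if "i < g" for i
        using that by (auto simp: braid_gens_def)
      thus "set (generator_pairs g ?f) \<subseteq> \<phi> ` carrier (braid_group2 g) \<times> \<phi> ` carrier (braid_group2 g)"
        using fK by (auto simp: generator_pairs_def)
    qed
    thus ?thesis using h.hom_closed by blast
  qed
  thus ?thesis using ord \<phi> by (auto simp: admissible_epis_def epi_def)
qed

lemma bij_betw_admissible_epis:
  assumes odd: "odd (order G)" and ord_G: "order G = p ^ (2 * g + 1)" and g: "g \<ge> 1"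
  shows "bij_betw (\<lambda>\<phi>. \<lambda>x\<in>braid_gens g. \<phi> (word_class (braid_gens g) (braid_rels g) (gen_word x)))
    (admissible_epis g G)
    {f \<in> braid_gens g \<rightarrow>\<^sub>E carrier G. f GenS \<in> center G - {\<one>} \<and>
       generator_pairs g f \<in> frames G (f GenS \<otimes> f GenS) (carrier G) g \<and> p dvd g + 1}"
    (is "bij_betw ?F _ ?T")
proof -
  let ?H = "{\<phi> \<in> hom (braid_group2 g) G. \<phi> \<in> extensional (carrier (braid_group2 g))}"
  let ?A = "{f \<in> braid_gens g \<rightarrow>\<^sub>E carrier G. \<forall>(l, r)\<in>braid_rels g. word_value G f l = word_value G f r}"
  have "bij_betw ?F {\<phi> \<in> ?H. \<phi> (braid_sigma g) \<noteq> \<one>} {f \<in> ?A. f GenS \<noteq> \<one>}"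
  proof (rule bij_betw_Collect)
    show "bij_betw ?F ?H ?A"
      unfolding braid_group2_def using bij_betw_presented_homs[OF braid_rels_in_words] .
  qed (simp add: braid_sigma_def braid_gens_def)
  moreover have "{\<phi> \<in> ?H. \<phi> (braid_sigma g) \<noteq> \<one>} = admissible_epis g G"
  proof -
    have "admissible_epis g G \<subseteq> ?H" by (auto simp: admissible_epis_def epi_def)
    thus ?thesis using admissible_epis_iff[OF odd ord_G g] by blast
  qed
  moreover have "{f \<in> ?A. f GenS \<noteq> \<one>} = ?T"
  proof (intro Collect_eqI)
    fix f
    show "(f \<in> ?A \<and> f GenS \<noteq> \<one>) \<longleftrightarrow> (f \<in> braid_gens g \<rightarrow>\<^sub>E carrier G \<and> f GenS \<in> center G - {\<one>} \<and>
       generator_pairs g f \<in> frames G (f GenS \<otimes> f GenS) (carrier G) g \<and> p dvd g + 1)"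
    proof (cases "f \<in> braid_gens g \<rightarrow>\<^sub>E carrier G \<and> f GenS \<noteq> \<one>")
      case True
      hence "f \<in> braid_gens g \<rightarrow> carrier G" by (simp add: PiE_iff Pi_iff)
      thus ?thesis using True respects_braid_rels_iff[OF odd _ _ g, of f] by blast
    qed auto
  qed
  ultimately show ?thesis by simp
qed

lemma admissible_epis_empty:
  assumes "odd (order G)" "order G = p ^ (2 * g + 1)" "g \<ge> 1" "\<not> p dvd g + 1"
  shows "admissible_epis g G = {}"
  using bij_betw_admissible_epis[OF assms(1-3)] assms(4) by (simp add: bij_betw_empty2)

lemma num_admissible_epis_eq:
  assumes odd: "odd (order G)" and ord_G: "order G = p ^ (2 * g + 1)" and g: "g \<ge> 1"
    and p: "p dvd g + 1"
  shows "num_admissible_epis g G = (p - 1) * p ^ (g * (g + 2)) * (\<Prod>i = 1..g. p ^ (2 * i) - 1)"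
proof -
  let ?N = "p ^ (g * (g + 2)) * (\<Prod>i = 1..g. p ^ (2 * i) - 1)"
  let ?R = "\<lambda>s. frames G (s \<otimes> s) (carrier G) g"
  let ?T = "{f \<in> braid_gens g \<rightarrow>\<^sub>E carrier G. f GenS \<in> center G - {\<one>} \<and> generator_pairs g f \<in> ?R (f GenS)}"
  have one: "\<one> \<in> center G" using subgroup.one_closed[OF center_subgroup] .
  have finZ: "finite (center G)" using finite_carrier by (auto simp: center_def)
  have "num_admissible_epis g G = card ?T"
    unfolding num_admissible_epis_def
    using bij_betw_same_card[OF bij_betw_admissible_epis[OF odd ord_G g]] p by simp
  also have "\<dots> = card (SIGMA s:center G - {\<one>}. ?R s)"
    by (rule bij_betw_same_card[OF bij_betw_generator_pairs])
       (auto simp: frames_def center_def)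
  also have "\<dots> = (\<Sum>s\<in>center G - {\<one>}. card (?R s))"
    using finZ finite_frames[OF finite_carrier] by (intro card_SigmaI) auto
  also have "\<dots> = (\<Sum>s\<in>center G - {\<one>}. ?N)"
  proof (rule sum.cong)
    fix s assume s: "s \<in> center G - {\<one>}"
    hence sZ: "s \<in> center G" and sc: "s \<in> carrier G" by (auto simp: center_def)
    have "s \<otimes> s \<in> center G" using subgroup.m_closed[OF center_subgroup sZ sZ] .
    moreover have "s \<otimes> s \<noteq> \<one>"
      using mem_subgroup_if_square_mem[OF finite_carrier odd sc triv_subgroup] s by auto
    ultimately show "card (?R s) = ?N"
      using card_frames[OF nondegenerate_carrier] ord_G by (simp add: order_def)
  qed simp
  also have "\<dots> = (p - 1) * ?N"
    using one finZ card_center by simp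
  finally show ?thesis by (simp add: mult.assoc)
qed

end

text \<open>Commutators are central because the quotient by the centre is abelian.\<close>

lemma extra_special_imp_prime_center_group:
  assumes "extra_special p G"
  shows "prime_center_group G p"
proof -
  interpret group G using assms by (simp add: extra_special_def)
  have Z: "subgroup (center G) G" by (rule center_subgroup)
  interpret N: normal "center G" G
  proof (rule normal_invI[OF Z])
    fix x h assume x: "x \<in> carrier G" and h: "h \<in> center G"
    have "x \<otimes>\<^bsub>G\<^esub> h = h \<otimes>\<^bsub>G\<^esub> x" and hc: "h \<in> carrier G"
      using x h by (auto simp: center_def)
    hence "x \<otimes>\<^bsub>G\<^esub> h \<otimes>\<^bsub>G\<^esub> inv\<^bsub>G\<^esub> x = h"
      using x by (simp add: m_assoc)
    thus "x \<otimes>\<^bsub>G\<^esub> h \<otimes>\<^bsub>G\<^esub> inv\<^bsub>G\<^esub> x \<in> center G" using h by simp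
  qed
  interpret Q: comm_group "G Mod center G"
    using assms by (simp add: extra_special_def elementary_abelian_def)
  interpret h: group_hom G "G Mod center G" "\<lambda>a. center G #>\<^bsub>G\<^esub> a"
    using N.r_coset_hom_Mod by unfold_locales
  have "commutator G x y \<in> center G" if "x \<in> carrier G" "y \<in> carrier G" for x y
  proof -
    have xy: "x \<otimes>\<^bsub>G\<^esub> y = commutator G x y \<otimes>\<^bsub>G\<^esub> (y \<otimes>\<^bsub>G\<^esub> x)"
      using that commutator_eq_iff commutator_closed by blast
    have "center G #>\<^bsub>G\<^esub> (y \<otimes>\<^bsub>G\<^esub> x) = center G #>\<^bsub>G\<^esub> (x \<otimes>\<^bsub>G\<^esub> y)"
      using that by (simp only: h.hom_mult Q.m_comm h.hom_closed)
    moreover have "x \<otimes>\<^bsub>G\<^esub> y \<in> center G #>\<^bsub>G\<^esub> (x \<otimes>\<^bsub>G\<^esub> y)"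
      using that by (intro rcos_self[OF _ Z] m_closed)
    ultimately have "x \<otimes>\<^bsub>G\<^esub> y \<in> center G #>\<^bsub>G\<^esub> (y \<otimes>\<^bsub>G\<^esub> x)" by (simp only:)
    then obtain z where z: "z \<in> center G" "x \<otimes>\<^bsub>G\<^esub> y = z \<otimes>\<^bsub>G\<^esub> (y \<otimes>\<^bsub>G\<^esub> x)"
      by (auto simp: r_coset_def)
    thus ?thesis
      using that commutator_eq_iff[of x y z] center_imp_carrier by simp
  qed
  thus ?thesis
    using assms by unfold_locales (auto simp: extra_special_def)
qed

theorem theoremC:
  fixes g p :: nat
    and G :: "('a, 'm) monoid_scheme"
    and H :: "('b, 'n) monoid_scheme"
  assumes "g \<ge> 2"
    and "Factorial_Ring.prime p" and "odd p"
    and "extra_special p G" and "order G = p ^ (2 * g + 1)"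
  shows "(admissible_quotient g G \<longleftrightarrow> [int g = - 1] (mod int p)) \<and>
    ([int g = - 1] (mod int p) \<longrightarrow>
       num_admissible_epis g G = (p - 1) * p ^ (g * (g + 2)) * (\<Prod>i = 1..g. p ^ (2 * i) - 1)) \<and>
    (extra_special p H \<and> order H = p ^ (2 * g + 1) \<longrightarrow>
       num_admissible_epis g G = num_admissible_epis g H)"
proof -
  let ?N = "(p - 1) * p ^ (g * (g + 2)) * (\<Prod>i = 1..g. p ^ (2 * i) - 1)"
  interpret G: prime_center_group G p
    using assms(4) by (rule extra_special_imp_prime_center_group)
  have g: "g \<ge> 1" using assms(1) by simp
  have odd: "odd (p ^ (2 * g + 1))" using assms(3) by simp
  have cong: "[int g = - 1] (mod int p) \<longleftrightarrow> p dvd g + 1"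
  proof -
    have "[int g = - 1] (mod int p) \<longleftrightarrow> int p dvd int (g + 1)" by (simp add: cong_iff_dvd_diff add.commute)
    thus ?thesis by (simp only: of_nat_dvd_iff)
  qed
  have p2: "p \<ge> 2" using assms(2) by (rule prime_ge_2_nat)
  have "p ^ (2 * i) > 1" if "i \<ge> 1" for i :: nat
    using p2 that by (intro one_less_power) auto
  hence "(\<Prod>i = 1..g. p ^ (2 * i) - 1) > 0" by (intro prod_pos) auto
  hence pos: "?N > 0" using p2 by simp
  have count_G: "num_admissible_epis g G = ?N" if "p dvd g + 1"
    using G.num_admissible_epis_eq[OF _ assms(5) g that] odd assms(5) by simp
  have empty_G: "admissible_epis g G = {}" if "\<not> p dvd g + 1"
    using G.admissible_epis_empty[OF _ assms(5) g that] odd assms(5) by simp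
  have "admissible_quotient g G \<longleftrightarrow> p dvd g + 1"
  proof (cases "p dvd g + 1")
    case True
    hence "card (admissible_epis g G) > 0"
      using count_G pos by (simp only: num_admissible_epis_def[symmetric])
    thus ?thesis using True by (auto simp: admissible_quotient_def)
  qed (use empty_G in \<open>simp add: admissible_quotient_def\<close>)
  moreover have "num_admissible_epis g G = num_admissible_epis g H"
    if H: "extra_special p H" "order H = p ^ (2 * g + 1)"
  proof -
    interpret H: prime_center_group H p
      using H(1) by (rule extra_special_imp_prime_center_group)
    show ?thesis
    proof (cases "p dvd g + 1")
      case True
      thus ?thesis using count_G H.num_admissible_epis_eq[OF _ H(2) g] odd H(2) by simp
    next
      case False
      thus ?thesis using empty_G H.admissible_epis_empty[OF _ H(2) g] odd H(2)
        by (simp add: num_admissible_epis_def)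
    qed
  qed
  ultimately show ?thesis using count_G cong by blast
qed

end
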